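(* Let $I\subseteq(0,\infty)$ be an interval, let $f:I\to\mathbb{R}$ be differentiable on the interior $I^{\circ}$ of $I$, and let $a,b\in I^{\circ}$ with $a<b$ be such that $|f'|$ is GA-convex on $[a,b]$. Let $g:[a,b]\to[0,\infty)$ be a continuous positive function that is geometrically symmetric with respect to $\sqrt{ab}$, let $\alpha>0$, and put $G=\sqrt{ab}$ and $\|g\|_\infty=\sup_{x\in[a,b]}|g(x)|$. Then $$\left|\frac{f(a)+f(b)}{2}\left[J_{a^+}^{\alpha}g(b)+J_{b^-}^{\alpha}g(a)\right]-\left[J_{a^+}^{\alpha}(fg)(b)+J_{b^-}^{\alpha}(fg)(a)\right]\right|$$ $$\le\frac{(\ln b-\ln a)^{\alpha+1}}{2^{\alpha+1}\Gamma(\alpha+1)}\|g\|_\infty\Big[C_1(\alpha)|f'(a)|+C_2(\alpha)|f'(G)|+C_3(\alpha)|f'(b)|\Big],$$ where $$C_1(\alpha)=\int_0^1\left[(1+t)^\alpha-(1-t)^\alpha\right]t\,a^tG^{1-t}\,dt,$$ $$C_2(\alpha)=\int_0^1(1-t)\left[(1+t)^\alpha-(1-t)^\alpha\right]\left[a^tG^{1-t}+b^tG^{1-t}\right]dt,$$ $$C_3(\alpha)=\int_0^1\left[(1+t)^\alpha-(1-t)^\alpha\right]t\,b^tG^{1-t}\,dt.$$ Moreover, if $0<\alpha\le1$, then $$\left|\frac{f(a)+f(b)}{2}\left[J_{a^+}^{\alpha}g(b)+J_{b^-}^{\alpha}g(a)\right]-\left[J_{a^+}^{\alpha}(fg)(b)+J_{b^-}^{\alpha}(fg)(a)\right]\right|$$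 $$\le\frac{(\ln b-\ln a)^{\alpha+1}}{2\,\Gamma(\alpha+1)}\|g\|_\infty\Big[D_1(\alpha)|f'(a)|+D_2(\alpha)|f'(G)|+D_3(\alpha)|f'(b)|\Big],$$ where $$D_1(\alpha)=\int_0^1t^{\alpha+1}a^tG^{1-t}\,dt,\qquad D_2(\alpha)=\int_0^1\left[(1-t)t^\alpha a^tG^{1-t}+(1-t)t^\alpha b^tG^{1-t}\right]dt,\qquad D_3(\alpha)=\int_0^1t^{\alpha+1}b^tG^{1-t}\,dt.$$
   Context: A function $\varphi:J\to\mathbb{R}$ on an interval $J\subseteq(0,\infty)$ is GA-convex on $J$ if $\varphi(x^{\lambda}y^{1-\lambda})\le\lambda\varphi(x)+(1-\lambda)\varphi(y)$ for all $x,y\in J$ and $\lambda\in[0,1]$. A function $g$ on $[a,b]$ is geometrically symmetric with respect to $\sqrt{ab}$ if $g(ab/x)=g(x)$ for all $x\in[a,b]$. For integrable $u$ on $[a,b]$ and $\alpha>0$, the Hadamard fractional integrals of order $\alpha$ are $$J_{a^+}^{\alpha}u(x)=\frac1{\Gamma(\alpha)}\int_a^x\left(\ln\frac xt\right)^{\alpha-1}u(t)\frac{dt}{t}\quad(x>a),\qquad J_{b^-}^{\alpha}u(x)=\frac1{\Gamma(\alpha)}\int_x^b\left(\ln\frac tx\right)^{\alpha-1}u(t)\frac{dt}{t}\quad(x<b),$$ where $\Gamma$ is the Gamma function. $fg$ denotes the pointwise product. *)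

theory Defs
  imports "HOL-Analysis.Analysis"
begin

definition GA_convex_on :: "real set \<Rightarrow> (real \<Rightarrow> real) \<Rightarrow> bool" where
  "GA_convex_on J \<phi> \<longleftrightarrow> is_interval J \<and> J \<subseteq> {0<..} \<and>
     (\<forall>x\<in>J. \<forall>y\<in>J. \<forall>l\<in>{0..1}.
        \<phi> (x powr l * y powr (1 - l)) \<le> l * \<phi> x + (1 - l) * \<phi> y)"

definition geom_symmetric_on :: "real \<Rightarrow> real \<Rightarrow> (real \<Rightarrow> real) \<Rightarrow> bool" where
  "geom_symmetric_on a b g \<longleftrightarrow> (\<forall>x\<in>{a..b}. g (a * b / x) = g x)"

text \<open>
  Hadamard fractional integrals of order \<open>\<alpha>\<close>. For \<open>\<alpha> < 1\<close> the kernel is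
  singular at \<open>t = x\<close>; there \<open>0 powr (\<alpha> - 1) = 0\<close>, which is immaterial because
  a single point does not affect the integral.
\<close>

definition hadamard_left :: "real \<Rightarrow> real \<Rightarrow> (real \<Rightarrow> real) \<Rightarrow> real \<Rightarrow> real" where
  "hadamard_left \<alpha> a u x =
     1 / Gamma \<alpha> * integral {a..x} (\<lambda>t. ln (x / t) powr (\<alpha> - 1) * u t / t)"

definition hadamard_right :: "real \<Rightarrow> real \<Rightarrow> (real \<Rightarrow> real) \<Rightarrow> real \<Rightarrow> real" where
  "hadamard_right \<alpha> b u x =
     1 / Gamma \<alpha> * integral {x..b} (\<lambda>t. ln (t / x) powr (\<alpha> - 1) * u t / t)"

definition sup_norm_on :: "real \<Rightarrow> real \<Rightarrow> (real \<Rightarrow> real) \<Rightarrow> real" where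
  "sup_norm_on a b g = (SUP x\<in>{a..b}. \<bar>g x\<bar>)"

text \<open>
  The coefficients \<open>C\<^sub>i(\<alpha>)\<close> and \<open>D\<^sub>i(\<alpha>)\<close> also depend on \<open>a\<close>, \<open>b\<close> and
  \<open>G\<close>, which are explicit arguments here; \<open>G\<close> is meant to be \<open>sqrt (a * b)\<close>.
\<close>

definition C1 :: "real \<Rightarrow> real \<Rightarrow> real \<Rightarrow> real" where
  "C1 a G \<alpha> = integral {0..1}
     (\<lambda>t. ((1 + t) powr \<alpha> - (1 - t) powr \<alpha>) * t * a powr t * G powr (1 - t))"

definition C2 :: "real \<Rightarrow> real \<Rightarrow> real \<Rightarrow> real \<Rightarrow> real" where
  "C2 a b G \<alpha> = integral {0..1}
     (\<lambda>t. (1 - t) * ((1 + t) powr \<alpha> - (1 - t) powr \<alpha>) *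
           (a powr t * G powr (1 - t) + b powr t * G powr (1 - t)))"

definition C3 :: "real \<Rightarrow> real \<Rightarrow> real \<Rightarrow> real" where
  "C3 b G \<alpha> = integral {0..1}
     (\<lambda>t. ((1 + t) powr \<alpha> - (1 - t) powr \<alpha>) * t * b powr t * G powr (1 - t))"

definition D1 :: "real \<Rightarrow> real \<Rightarrow> real \<Rightarrow> real" where
  "D1 a G \<alpha> = integral {0..1} (\<lambda>t. t powr (\<alpha> + 1) * a powr t * G powr (1 - t))"

definition D2 :: "real \<Rightarrow> real \<Rightarrow> real \<Rightarrow> real \<Rightarrow> real" where
  "D2 a b G \<alpha> = integral {0..1}
     (\<lambda>t. (1 - t) * t powr \<alpha> * a powr t * G powr (1 - t) +
           (1 - t) * t powr \<alpha> * b powr t * G powr (1 - t))"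

definition D3 :: "real \<Rightarrow> real \<Rightarrow> real \<Rightarrow> real" where
  "D3 b G \<alpha> = integral {0..1} (\<lambda>t. t powr (\<alpha> + 1) * b powr t * G powr (1 - t))"

end

theory Submission
  imports Defs
begin

text \<open>
  Substitute \<open>x = G (b/a)\<^bsup>t/2\<^esup>\<close> with \<open>t \<in> [-1, 1]\<close>. Since \<open>g\<close> becomes even, both sides fold to
  \<open>[0, 1]\<close>, and the difference to be estimated is a constant times
  \<open>\<integral> k w (\<psi>(1) - \<psi>(t)) dt\<close>, where \<open>\<psi>(t) = f(x(t)) + f(x(-t))\<close>, \<open>w(t) = g(x(t))\<close> and
  \<open>k(t) = (1-t)\<^bsup>\<alpha>-1\<^esup> + (1+t)\<^bsup>\<alpha>-1\<^esup>\<close>. GA-convexity bounds \<open>\<bar>\<psi>'\<bar>\<close> by an explicit continuous function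
  \<open>H\<close>, so that \<open>\<bar>\<psi>(1) - \<psi>(t)\<bar> \<le> \<integral>\<^sub>t\<^sup>1 H\<close> without any measurability assumption on \<open>f'\<close>;
  integrating by parts against the primitive \<open>((1+t)\<^sup>\<alpha> - (1-t)\<^sup>\<alpha>)/\<alpha>\<close> of \<open>k\<close> gives the first bound.
  For \<open>\<alpha> \<le> 1\<close>, subadditivity of \<open>t\<^sup>\<alpha>\<close> yields \<open>(1+t)\<^sup>\<alpha> - (1-t)\<^sup>\<alpha> \<le> (2t)\<^sup>\<alpha>\<close> and hence the second.
\<close>

section \<open>An elementary inequality for powers with exponent at most 1\<close>

text \<open>After division by \<open>s = x + y\<close> both ratios lie in [0, 1], where lowering the
  exponent from 1 to \<open>\<alpha>\<close> can only increase a power; the two ratios sum to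
  1.\<close>

lemma powr_subadditive:
  fixes x y \<alpha> :: real
  assumes "0 \<le> x" "0 \<le> y" "0 < \<alpha>" "\<alpha> \<le> 1"
  shows "(x + y) powr \<alpha> \<le> x powr \<alpha> + y powr \<alpha>"
proof (cases "x + y = 0")
  case True
  then show ?thesis using assms by simp
next
  case False
  define s where "s = x + y"
  have s: "s > 0" using False assms by (simp add: s_def)
  have *: "z / s * s powr \<alpha> \<le> z powr \<alpha>" if "0 \<le> z" "z \<le> s" for z
  proof -
    have "(z / s) powr 1 \<le> (z / s) powr \<alpha>"
      using that s assms by (intro powr_mono') auto
    then have "z / s * s powr \<alpha> \<le> (z / s) powr \<alpha> * s powr \<alpha>"
      using that s by (intro mult_right_mono) auto
    also have "\<dots> = z powr \<alpha>"
      using that s by (simp add: powr_divide)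
    finally show ?thesis .
  qed
  have "s powr \<alpha> = x / s * s powr \<alpha> + y / s * s powr \<alpha>"
    using s by (simp add: s_def flip: add_divide_distrib distrib_right)
  also have "\<dots> \<le> x powr \<alpha> + y powr \<alpha>"
    using assms by (intro add_mono *) (auto simp: s_def)
  finally show ?thesis by (simp add: s_def)
qed

section \<open>Integrability against the singular kernels\<close>

text \<open>For \<open>\<alpha> < 1\<close> the kernel blows up at 1, but its primitive
  \<open>- (1 - t) powr \<alpha> / \<alpha>\<close> stays continuous there, so the kernel is
  integrable. Being nonnegative it is absolutely integrable, and this survives multiplication by the
  bounded measurable \<open>v\<close>.\<close>

lemma absolutely_integrable_powr_mult_left:
  fixes v :: "real \<Rightarrow> real"
  assumes "0 < \<alpha>" "c \<le> 1" "continuous_on {c..1} v"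
  shows "(\<lambda>t. (1 - t) powr (\<alpha> - 1) * v t) absolutely_integrable_on {c..1}"
proof -
  have "((\<lambda>t. (1 - t) powr (\<alpha> - 1)) has_integral
          (- ((1 - 1) powr \<alpha> / \<alpha>)) - (- ((1 - c) powr \<alpha> / \<alpha>))) {c..1}"
    using assms
    by (intro fundamental_theorem_of_calculus_interior continuous_intros continuous_on_powr')
       (auto intro!: derivative_eq_intros simp flip: has_real_derivative_iff_has_vector_derivative)
  then have "(\<lambda>t. (1 - t) powr (\<alpha> - 1)) absolutely_integrable_on {c..1}"
    by (intro nonnegative_absolutely_integrable_1) (auto simp: has_integral_integrable)
  moreover have "bounded (v ` {c..1})"
    using assms by (intro compact_imp_bounded compact_continuous_image) auto
  moreover have "v \<in> borel_measurable (lebesgue_on {c..1})"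
    using assms by (intro continuous_imp_measurable_on_sets_lebesgue) auto
  ultimately have "(\<lambda>t. v t * (1 - t) powr (\<alpha> - 1)) absolutely_integrable_on {c..1}"
    by (intro absolutely_integrable_bounded_measurable_product_real) auto
  then show ?thesis by (simp add: mult.commute)
qed

text \<open>The mirror image of the previous lemma under the reflection of \<open>t\<close> to
  \<open>- t\<close>, which explains the endpoint \<open>- c\<close>.\<close>

lemma absolutely_integrable_powr_mult_right:
  fixes v :: "real \<Rightarrow> real"
  assumes "0 < \<alpha>" "c \<le> 1" "continuous_on {-1..-c} v"
  shows "(\<lambda>t. (1 + t) powr (\<alpha> - 1) * v t) absolutely_integrable_on {-1..-c}"
proof -
  have "continuous_on {c..1} (\<lambda>t. v (- t))"
    by (rule continuous_on_compose2[OF assms(3)]) (auto intro!: continuous_intros)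
  then have "(\<lambda>t. (1 - t) powr (\<alpha> - 1) * v (- t)) absolutely_integrable_on {c..1}"
    by (intro absolutely_integrable_powr_mult_left assms)
  then show ?thesis
    by (subst (asm) absolutely_integrable_reflect_real[symmetric]) simp
qed

text \<open>On [0, 1] only the first summand of the kernel can be singular; the base
  \<open>1 + t\<close> of the second stays at least 1.\<close>

lemma absolutely_integrable_symmetric_kernel:
  fixes v :: "real \<Rightarrow> real"
  assumes "0 < \<alpha>" "continuous_on {0..1} v"
  shows "(\<lambda>t. ((1 - t) powr (\<alpha> - 1) + (1 + t) powr (\<alpha> - 1)) * v t) absolutely_integrable_on {0..1}"
proof -
  have "(\<lambda>t. (1 + t) powr (\<alpha> - 1) * v t) absolutely_integrable_on {0..1}"
    using assms by (intro absolutely_integrable_continuous_real continuous_intros) auto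
  with absolutely_integrable_powr_mult_left[OF assms(1) _ assms(2)] show ?thesis
    unfolding distrib_right by (intro set_integral_add) auto
qed

section \<open>Estimating a weighted integral of increments\<close>

text \<open>Increments of \<open>\<psi>\<close> are dominated by the tail integrals \<open>Q\<close>
  of \<open>H\<close>. Integration by parts then moves the kernel from \<open>Q\<close> to its
  primitive \<open>W\<close> against \<open>H\<close>, which removes the singularity at 1.\<close>

lemma weighted_increment_bound:
  fixes \<psi> w H :: "real \<Rightarrow> real"
  assumes \<alpha>: "0 < \<alpha>"
    and \<psi>: "continuous_on {0..1} \<psi>"
    and \<psi>': "\<And>t. t \<in> {0<..<1} \<Longrightarrow> (\<psi> has_real_derivative \<psi>' t) (at t)"
    and H: "continuous_on {0..1} H" "\<And>t. t \<in> {0<..<1} \<Longrightarrow> \<bar>\<psi>' t\<bar> \<le> H t"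
    and w: "continuous_on {0..1} w" "\<And>t. t \<in> {0..1} \<Longrightarrow> \<bar>w t\<bar> \<le> N"
  shows "\<bar>integral {0..1} (\<lambda>t. ((1 - t) powr (\<alpha> - 1) + (1 + t) powr (\<alpha> - 1)) * (w t * (\<psi> 1 - \<psi> t)))\<bar>
     \<le> N / \<alpha> * integral {0..1} (\<lambda>t. ((1 + t) powr \<alpha> - (1 - t) powr \<alpha>) * H t)"
proof -
  define k where "k = (\<lambda>t::real. (1 - t) powr (\<alpha> - 1) + (1 + t) powr (\<alpha> - 1))"
  define W where "W = (\<lambda>t::real. ((1 + t) powr \<alpha> - (1 - t) powr \<alpha>) / \<alpha>)"
  define Q where "Q = (\<lambda>t. integral {t..1} H)"
  have k_int: "(\<lambda>t. k t * v t) absolutely_integrable_on {0..1}"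
    if "continuous_on {0..1} v" for v
    unfolding k_def using \<alpha> that by (rule absolutely_integrable_symmetric_kernel)
  have N: "0 \<le> N" using w(2)[of 0] by auto
  have Q_cont: "continuous_on {0..1} Q"
    unfolding Q_def
    by (intro indefinite_integral_continuous_1' integrable_continuous_interval H)
  have Q_deriv: "(Q has_real_derivative - H t) (at t)" if "t \<in> {0<..<1}" for t
  proof -
    have "(Q has_real_derivative - H t) (at t within {0..1})"
      unfolding Q_def using that by (intro integral_has_real_derivative' H) auto
    moreover have "at t within {0..1} = at t"
      using that by (intro at_within_interior) (auto simp: interior_atLeastAtMost_real)
    ultimately show ?thesis by simp
  qed
  have incr: "\<bar>\<psi> 1 - \<psi> t\<bar> \<le> Q t" if t: "t \<in> {0..1}" for t
  proof (cases "t = 1")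
    case True
    then show ?thesis by (simp add: Q_def)
  next
    case False
    \<comment> \<open>Mean value comparison with \<open>- Q\<close>, whose derivative is
      \<open>H\<close>: a pointwise bound on \<open>\<psi>'\<close> suffices, so
      \<open>\<psi>'\<close> is never integrated.\<close>
    have "norm (\<psi> 1 - \<psi> t) \<le> (- Q 1) - (- Q t)"
    proof (rule differentiable_bound_general)
      show "t < 1" using False t by auto
      show "continuous_on {t..1} \<psi>" "continuous_on {t..1} (\<lambda>x. - Q x)"
        using t by (auto intro!: continuous_intros continuous_on_subset[OF \<psi>] continuous_on_subset[OF Q_cont])
      show "(\<psi> has_vector_derivative \<psi>' x) (at x)" if "t < x" "x < 1" for x
        using \<psi>'[of x] that t by (auto simp: has_real_derivative_iff_has_vector_derivative)
      show "((\<lambda>x. - Q x) has_vector_derivative H x) (at x)" if "t < x" "x < 1" for x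
        using DERIV_minus[OF Q_deriv[of x]] that t
        by (auto simp: has_real_derivative_iff_has_vector_derivative)
      show "norm (\<psi>' x) \<le> H x" if "t < x" "x < 1" for x
        using H(2)[of x] that t by auto
    qed
    then show ?thesis by (simp add: Q_def)
  qed
  have W_cont: "continuous_on {0..1} W"
    unfolding W_def using \<alpha> by (intro continuous_intros continuous_on_powr') auto
  have W_deriv: "(W has_real_derivative k t) (at t)" if "t \<in> {0<..<1}" for t
    unfolding W_def k_def using \<alpha> that
    by (auto intro!: derivative_eq_intros simp: field_simps)
  \<comment> \<open>The product \<open>W * Q\<close> is continuous up to 1 even when
    \<open>k\<close> is not. Both boundary terms vanish, because \<open>Q 1 = 0\<close> and
    \<open>W 0 = 0\<close>.\<close>
  have "((\<lambda>t. W t * - H t + k t * Q t) has_integral W 1 * Q 1 - W 0 * Q 0) {0..1}"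
  proof (rule fundamental_theorem_of_calculus_interior)
    show "continuous_on {0..1} (\<lambda>t. W t * Q t)"
      by (intro continuous_intros W_cont Q_cont)
    show "((\<lambda>t. W t * Q t) has_vector_derivative W t * - H t + k t * Q t) (at t)"
      if "t \<in> {0<..<1}" for t
      using DERIV_mult'[OF W_deriv[OF that] Q_deriv[OF that]]
      by (simp add: has_real_derivative_iff_has_vector_derivative)
  qed auto
  then have "integral {0..1} (\<lambda>t. W t * - H t + k t * Q t) = 0"
    by (intro integral_unique) (simp add: W_def Q_def)
  moreover have "(\<lambda>t. W t * - H t) integrable_on {0..1}"
    by (intro integrable_continuous_interval continuous_intros W_cont H)
  moreover have kQ: "(\<lambda>t. k t * Q t) integrable_on {0..1}"
    using k_int[OF Q_cont] by (rule set_lebesgue_integral_eq_integral(1))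
  ultimately have by_parts: "integral {0..1} (\<lambda>t. k t * Q t) = integral {0..1} (\<lambda>t. W t * H t)"
    by (subst (asm) integral_add) (auto simp: integral_neg)
  have "norm (integral {0..1} (\<lambda>t. k t * (w t * (\<psi> 1 - \<psi> t))))
      \<le> integral {0..1} (\<lambda>t. N * (k t * Q t))"
  proof (rule integral_norm_bound_integral)
    show "(\<lambda>t. k t * (w t * (\<psi> 1 - \<psi> t))) integrable_on {0..1}"
      by (intro set_lebesgue_integral_eq_integral(1) k_int continuous_intros w \<psi>)
    show "(\<lambda>t. N * (k t * Q t)) integrable_on {0..1}"
      using integrable_on_cmult_left[OF kQ, of N] by simp
    fix t :: real assume t: "t \<in> {0..1}"
    have "\<bar>w t\<bar> * \<bar>\<psi> 1 - \<psi> t\<bar> \<le> N * Q t"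
      using w(2)[OF t] incr[OF t] N by (intro mult_mono) auto
    then have "k t * (\<bar>w t\<bar> * \<bar>\<psi> 1 - \<psi> t\<bar>) \<le> k t * (N * Q t)"
      by (intro mult_left_mono) (auto simp: k_def)
    moreover have "\<bar>k t\<bar> = k t" by (simp add: k_def)
    ultimately show "norm (k t * (w t * (\<psi> 1 - \<psi> t))) \<le> N * (k t * Q t)"
      by (simp add: abs_mult mult_ac)
  qed
  also have "\<dots> = N * integral {0..1} (\<lambda>t. W t * H t)"
    by (simp add: by_parts)
  also have "\<dots> = N / \<alpha> * integral {0..1} (\<lambda>t. ((1 + t) powr \<alpha> - (1 - t) powr \<alpha>) * H t)"
  proof -
    have "(\<lambda>t. W t * H t) = (\<lambda>t. 1 / \<alpha> * (((1 + t) powr \<alpha> - (1 - t) powr \<alpha>) * H t))"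
      by (simp add: W_def)
    then show ?thesis by (simp only: integral_mult_right) simp
  qed
  finally show ?thesis by (simp add: k_def)
qed

section \<open>Folding integrals over [-1, 1] onto [0, 1]\<close>

text \<open>Reflecting the second integral puts both under the kernel in \<open>1 - t\<close>,
  applied to the even function \<open>v t + v (- t)\<close>. Reflecting the half over [-1, 0] then
  changes that kernel to the one in \<open>1 + t\<close>.\<close>

lemma integral_symmetric_kernel:
  fixes v :: "real \<Rightarrow> real"
  assumes \<alpha>: "0 < \<alpha>" and v: "continuous_on {-1..1} v"
  shows "integral {-1..1} (\<lambda>t. (1 - t) powr (\<alpha> - 1) * v t) +
         integral {-1..1} (\<lambda>t. (1 + t) powr (\<alpha> - 1) * v t) =
         integral {0..1} (\<lambda>t. ((1 - t) powr (\<alpha> - 1) + (1 + t) powr (\<alpha> - 1)) * (v t + v (- t)))"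
    (is "?L + ?R = _")
proof -
  have v': "continuous_on {-1..1} (\<lambda>t. v (- t))"
    by (rule continuous_on_compose2[OF v]) (auto intro!: continuous_intros)
  let ?V = "\<lambda>t. (1 - t) powr (\<alpha> - 1) * (v t + v (- t))"
  let ?V' = "\<lambda>t. (1 + t) powr (\<alpha> - 1) * (v t + v (- t))"
  have V: "continuous_on {-1..1} (\<lambda>t. v t + v (- t))"
    by (intro continuous_intros v v')
  have V0: "continuous_on {0..1} (\<lambda>t. v t + v (- t))"
    by (rule continuous_on_subset[OF V]) auto
  have one_plus: "continuous_on {0..1} (\<lambda>t::real. (1 + t) powr (\<alpha> - 1))"
    by (intro continuous_intros) auto
  have int: "(\<lambda>t. (1 - t) powr (\<alpha> - 1) * u t) integrable_on {c..1}"
    if "continuous_on {c..1} u" "c \<le> 1" for u and c :: real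
    using that \<alpha> by (intro set_lebesgue_integral_eq_integral(1) absolutely_integrable_powr_mult_left)
  have "?R = integral {-1..1} (\<lambda>t. (1 - t) powr (\<alpha> - 1) * v (- t))"
    using Henstock_Kurzweil_Integration.integral_reflect_real[of 1 "-1" "\<lambda>t. (1 + t) powr (\<alpha> - 1) * v t"] by simp
  then have "?L + ?R = integral {-1..1} ?V"
    using integral_add[OF int[OF v] int[OF v']] by (simp add: distrib_left)
  also have "\<dots> = integral {-1..0} ?V + integral {0..1} ?V"
    using int[OF V] by (intro Henstock_Kurzweil_Integration.integral_combine[symmetric]) auto
  also have "integral {-1..0} ?V = integral {0..1} ?V'"
    using Henstock_Kurzweil_Integration.integral_reflect_real[of 1 0 ?V'] by (simp add: add.commute)
  also have "integral {0..1} ?V' + integral {0..1} ?V = integral {0..1} (\<lambda>t. ?V' t + ?V t)"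
    using int[OF V0] integrable_continuous_interval[OF continuous_on_mult[OF one_plus V0]]
    by (intro integral_add[symmetric]) auto
  finally show ?thesis by (simp add: algebra_simps)
qed

section \<open>The logarithmic parametrization of [a, b]\<close>

text \<open>The exponential of the affine map from [-1, 1] onto [ln a, ln b]; the geometric mean of
  \<open>a\<close> and \<open>b\<close> sits at parameter 0.\<close>

definition log_path :: "real \<Rightarrow> real \<Rightarrow> real \<Rightarrow> real" where
  "log_path a b t = exp ((ln a + ln b) / 2 + (ln b - ln a) / 2 * t)"

context
  fixes a b :: real
  assumes ab: "0 < a" "a < b"
begin

lemma log_path_pos: "0 < log_path a b t"
  by (simp add: log_path_def)

lemma log_path_1: "log_path a b 1 = b" and log_path_minus_1: "log_path a b (-1) = a"
  using ab by (simp_all add: log_path_def field_simps)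

lemma ln_log_path: "ln (log_path a b t) = (ln a + ln b) / 2 + (ln b - ln a) / 2 * t"
  by (simp add: log_path_def)

text \<open>Turns geometric symmetry of \<open>g\<close> into evenness in \<open>t\<close>: the
  logarithms at \<open>t\<close> and \<open>- t\<close> add up to
  \<open>ln a + ln b\<close>.\<close>

lemma log_path_reflect: "log_path a b (- t) = a * b / log_path a b t"
proof -
  have "log_path a b (- t) * log_path a b t = exp (ln a + ln b)"
    by (simp add: log_path_def flip: exp_add)
  also have "\<dots> = a * b" using ab by (simp add: exp_add)
  finally show ?thesis using log_path_pos[of t] by (simp add: field_simps)
qed

lemma log_path_deriv:
  "(log_path a b has_real_derivative (ln b - ln a) / 2 * log_path a b t) (at t within S)"
  unfolding log_path_def by (auto intro!: derivative_eq_intros)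

lemma log_path_mono: "s \<le> t \<Longrightarrow> log_path a b s \<le> log_path a b t"
  using ab by (simp add: log_path_def mult_left_mono)

lemma continuous_on_log_path: "continuous_on S (log_path a b)"
  unfolding log_path_def by (intro continuous_intros)

lemma log_path_in: "t \<in> {-1..1} \<Longrightarrow> log_path a b t \<in> {a..b}"
  using log_path_mono[of "-1" t] log_path_mono[of t 1] by (simp add: log_path_1 log_path_minus_1)

lemma log_path_image: "log_path a b ` {-1..1} = {a..b}"
proof
  show "log_path a b ` {-1..1} \<subseteq> {a..b}" using log_path_in by auto
  show "{a..b} \<subseteq> log_path a b ` {-1..1}"
  proof
    fix x assume "x \<in> {a..b}"
    then show "x \<in> log_path a b ` {-1..1}"
      using IVT'[of "log_path a b" "-1" x 1] continuous_on_log_path[of "{-1..1}"]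
      by (auto simp: log_path_1 log_path_minus_1)
  qed
qed

text \<open>For \<open>t\<close> in [0, 1] these are the weighted geometric means of
  \<open>G\<close> with an endpoint, the form to which GA-convexity applies and in which the
  coefficients are written.\<close>

lemma log_path_powr:
  assumes "G = sqrt (a * b)"
  shows "log_path a b t = b powr t * G powr (1 - t)"
    and "log_path a b (- t) = a powr t * G powr (1 - t)"
proof -
  have G: "G > 0" "ln G = (ln a + ln b) / 2"
    using ab assms by (simp_all add: ln_sqrt ln_mult)
  have "log_path a b t = exp (t * ln b + (1 - t) * ln G)"
    and "log_path a b (- t) = exp (t * ln a + (1 - t) * ln G)"
    unfolding log_path_def G(2) by (simp_all add: field_simps)
  then show "log_path a b t = b powr t * G powr (1 - t)"
    and "log_path a b (- t) = a powr t * G powr (1 - t)"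
    using ab G(1) by (simp_all add: powr_def exp_add)
qed

text \<open>Integrability is assumed in the parameter \<open>t\<close>, where the Hadamard kernels
  become powers of \<open>1 - t\<close> and \<open>1 + t\<close>. Change of variables for absolutely
  integrable functions tolerates their endpoint singularities.\<close>

lemma integral_log_path:
  fixes F :: "real \<Rightarrow> real"
  assumes "(\<lambda>t. (ln b - ln a) / 2 * log_path a b t * F (log_path a b t)) absolutely_integrable_on {-1..1}"
  shows "integral {a..b} F = integral {-1..1} (\<lambda>t. (ln b - ln a) / 2 * log_path a b t * F (log_path a b t))"
proof -
  have "inj_on (log_path a b) {-1..1}"
    using ab by (intro inj_onI) (simp add: log_path_def)
  moreover have "\<bar>(ln b - ln a) / 2 * log_path a b t\<bar> = (ln b - ln a) / 2 * log_path a b t" for t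
    using ab log_path_pos[of t] by simp
  ultimately have "(\<lambda>t. (ln b - ln a) / 2 * log_path a b t * F (log_path a b t)) absolutely_integrable_on {-1..1} \<and>
      integral {-1..1} (\<lambda>t. (ln b - ln a) / 2 * log_path a b t * F (log_path a b t)) = X \<longleftrightarrow>
      F absolutely_integrable_on {a..b} \<and> integral {a..b} F = X" for X
    using has_absolute_integral_change_of_variables_1'[of "{-1..1}" "log_path a b"
        "\<lambda>t. (ln b - ln a) / 2 * log_path a b t" F X, OF _ log_path_deriv]
    by (simp only: log_path_image) simp
  with assms show ?thesis by blast
qed

section \<open>Hadamard integrals in the logarithmic parameter\<close>

text \<open>With \<open>h = (ln b - ln a) / 2\<close>, the logarithms in the kernels become
  \<open>h * (1 - t)\<close> and \<open>h * (1 + t)\<close>, and dx / x becomes h dt. The powers of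
  \<open>h\<close> combine to \<open>h powr \<alpha>\<close>.\<close>

lemma
  assumes \<alpha>: "0 < \<alpha>" and u: "continuous_on {a..b} u"
  shows hadamard_left_log_path: "hadamard_left \<alpha> a u b = ((ln b - ln a) / 2) powr \<alpha> / Gamma \<alpha> *
           integral {-1..1} (\<lambda>t. (1 - t) powr (\<alpha> - 1) * u (log_path a b t))" (is ?left)
    and hadamard_right_log_path: "hadamard_right \<alpha> b u a = ((ln b - ln a) / 2) powr \<alpha> / Gamma \<alpha> *
           integral {-1..1} (\<lambda>t. (1 + t) powr (\<alpha> - 1) * u (log_path a b t))" (is ?right)
proof -
  let ?p = "log_path a b"
  define h where "h = (ln b - ln a) / 2"
  have h: "h > 0" using ab by (simp add: h_def)
  have up: "continuous_on {-1..1} (\<lambda>t. u (?p t))"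
    using log_path_in by (intro continuous_on_compose2[OF u continuous_on_log_path]) auto
  have kernel: "h * ?p t * ((h * s) powr (\<alpha> - 1) * u (?p t) / ?p t) =
      h powr \<alpha> * (s powr (\<alpha> - 1) * u (?p t))" if "0 \<le> s" for s t
  proof -
    have "h powr \<alpha> = h * h powr (\<alpha> - 1)" using h by (simp add: powr_mult_base)
    then show ?thesis using h that log_path_pos[of t] by (simp add: powr_mult)
  qed
  have "ln (b / ?p t) = h * (1 - t)" for t
    using ab log_path_pos[of t] by (simp add: ln_div ln_log_path h_def field_simps)
  then have left: "h * ?p t * (ln (b / ?p t) powr (\<alpha> - 1) * u (?p t) / ?p t) =
      h powr \<alpha> * ((1 - t) powr (\<alpha> - 1) * u (?p t))" if "t \<in> {-1..1}" for t
    using kernel[of "1 - t" t] that by simp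
  have "ln (?p t / a) = h * (1 + t)" for t
    using ab log_path_pos[of t] by (simp add: ln_div ln_log_path h_def field_simps)
  then have right: "h * ?p t * (ln (?p t / a) powr (\<alpha> - 1) * u (?p t) / ?p t) =
      h powr \<alpha> * ((1 + t) powr (\<alpha> - 1) * u (?p t))" if "t \<in> {-1..1}" for t
    using kernel[of "1 + t" t] that by simp
  have "(\<lambda>t. h * ?p t * (ln (b / ?p t) powr (\<alpha> - 1) * u (?p t) / ?p t)) absolutely_integrable_on {-1..1}"
    using absolutely_integrable_powr_mult_left[OF \<alpha> _ up]
    by (subst set_integrable_cong[OF refl refl left]) auto
  from integral_log_path[folded h_def, OF this]
  have "integral {a..b} (\<lambda>x. ln (b / x) powr (\<alpha> - 1) * u x / x) =
      integral {-1..1} (\<lambda>t. h * ?p t * (ln (b / ?p t) powr (\<alpha> - 1) * u (?p t) / ?p t))" .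
  also have "\<dots> = integral {-1..1} (\<lambda>t. h powr \<alpha> * ((1 - t) powr (\<alpha> - 1) * u (?p t)))"
    by (rule Henstock_Kurzweil_Integration.integral_cong) (rule left)
  finally have "integral {a..b} (\<lambda>x. ln (b / x) powr (\<alpha> - 1) * u x / x) =
      h powr \<alpha> * integral {-1..1} (\<lambda>t. (1 - t) powr (\<alpha> - 1) * u (?p t))"
    by simp
  then show ?left by (simp add: hadamard_left_def h_def)
  have "(\<lambda>t. h * ?p t * (ln (?p t / a) powr (\<alpha> - 1) * u (?p t) / ?p t)) absolutely_integrable_on {-1..1}"
    using absolutely_integrable_powr_mult_right[OF \<alpha>, of "-1"] up
    by (subst set_integrable_cong[OF refl refl right]) auto
  from integral_log_path[folded h_def, OF this]
  have "integral {a..b} (\<lambda>x. ln (x / a) powr (\<alpha> - 1) * u x / x) =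
      integral {-1..1} (\<lambda>t. h * ?p t * (ln (?p t / a) powr (\<alpha> - 1) * u (?p t) / ?p t))" .
  also have "\<dots> = integral {-1..1} (\<lambda>t. h powr \<alpha> * ((1 + t) powr (\<alpha> - 1) * u (?p t)))"
    by (rule Henstock_Kurzweil_Integration.integral_cong) (rule right)
  finally have "integral {a..b} (\<lambda>x. ln (x / a) powr (\<alpha> - 1) * u x / x) =
      h powr \<alpha> * integral {-1..1} (\<lambda>t. (1 + t) powr (\<alpha> - 1) * u (?p t))"
    by simp
  then show ?right by (simp add: hadamard_right_def h_def)
qed

lemma hadamard_sum_log_path:
  assumes \<alpha>: "0 < \<alpha>" and u: "continuous_on {a..b} u"
  shows "hadamard_left \<alpha> a u b + hadamard_right \<alpha> b u a = ((ln b - ln a) / 2) powr \<alpha> / Gamma \<alpha> *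
    integral {0..1} (\<lambda>t. ((1 - t) powr (\<alpha> - 1) + (1 + t) powr (\<alpha> - 1)) *
                          (u (log_path a b t) + u (log_path a b (- t))))"
proof -
  have "continuous_on {-1..1} (\<lambda>t. u (log_path a b t))"
    using log_path_in by (intro continuous_on_compose2[OF u continuous_on_log_path]) auto
  from integral_symmetric_kernel[OF \<alpha> this, symmetric] show ?thesis
    by (simp only: hadamard_left_log_path[OF \<alpha> u] hadamard_right_log_path[OF \<alpha> u] distrib_left)
qed

end

text \<open>Subadditivity for the splitting \<open>1 + t = (1 - t) + 2 * t\<close>.\<close>

lemma powr_diff_le:
  fixes t \<alpha> :: real
  assumes "0 \<le> t" "t \<le> 1" "0 < \<alpha>" "\<alpha> \<le> 1"
  shows "(1 + t) powr \<alpha> - (1 - t) powr \<alpha> \<le> 2 powr \<alpha> * t powr \<alpha>"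
  using powr_subadditive[of "1 - t" "2 * t" \<alpha>] assms by (simp add: powr_mult algebra_simps)

lemma abs_le_sup_norm_on:
  assumes "continuous_on {a..b} g" "x \<in> {a..b}"
  shows "\<bar>g x\<bar> \<le> sup_norm_on a b g"
proof -
  have "bdd_above ((\<lambda>x. \<bar>g x\<bar>) ` {a..b})"
    by (intro compact_imp_bounded[THEN bounded_imp_bdd_above] compact_continuous_image
        continuous_intros assms compact_Icc)
  then show ?thesis
    unfolding sup_norm_on_def using assms by (intro cSUP_upper) auto
qed

section \<open>The first bound\<close>

lemma hadamard_fejer_bound:
  fixes I :: "real set" and f g :: "real \<Rightarrow> real" and a b \<alpha> G :: real
  assumes "is_interval I" and I: "I \<subseteq> {0<..}"
    and f: "f differentiable_on interior I"
    and aI: "a \<in> interior I" and bI: "b \<in> interior I" and "a < b"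
    and GA: "GA_convex_on {a..b} (\<lambda>x. \<bar>deriv f x\<bar>)"
    and g: "continuous_on {a..b} g"
    and sym: "geom_symmetric_on a b g"
    and \<alpha>: "\<alpha> > 0"
    and G: "G = sqrt (a * b)"
  shows
    "\<bar>(f a + f b) / 2 * (hadamard_left \<alpha> a g b + hadamard_right \<alpha> b g a)
       - (hadamard_left \<alpha> a (\<lambda>x. f x * g x) b + hadamard_right \<alpha> b (\<lambda>x. f x * g x) a)\<bar>
     \<le> (ln b - ln a) powr (\<alpha> + 1) / (2 powr (\<alpha> + 1) * Gamma (\<alpha> + 1)) * sup_norm_on a b g
        * (C1 a G \<alpha> * \<bar>deriv f a\<bar> + C2 a b G \<alpha> * \<bar>deriv f G\<bar> + C3 b G \<alpha> * \<bar>deriv f b\<bar>)"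
proof -
  have ab: "0 < a" "a < b" using I aI \<open>a < b\<close> interior_subset by auto
  note [simp] = log_path_1[OF ab] log_path_minus_1[OF ab] log_path_pos[OF ab, THEN less_imp_le]
  let ?p = "log_path a b"
  define h where "h = (ln b - ln a) / 2"
  have h: "h > 0" using ab by (simp add: h_def)
  define N where "N = sup_norm_on a b g"
  let ?A = "\<bar>deriv f a\<bar>" and ?B = "\<bar>deriv f b\<bar>" and ?M = "\<bar>deriv f G\<bar>"
  have ab_I: "{a..b} \<subseteq> interior I"
    using aI bI \<open>is_interval I\<close>
    by (metis convex_interior interval_subset_is_interval is_interval_convex_1 box_real(2) empty_iff)
  have f_deriv: "(f has_real_derivative deriv f x) (at x)" if "x \<in> {a..b}" for x
    using f that ab_I
    by (metis DERIV_deriv_iff_real_differentiable at_within_open differentiable_on_def open_interior subsetD)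
  have f_cont: "continuous_on {a..b} f"
    using f_deriv by (meson DERIV_isCont continuous_at_imp_continuous_on)
  have p_in: "?p t \<in> {a..b}" if "t \<in> {-1..1}" for t
    using log_path_in[OF ab that] .
  have comp_cont: "continuous_on S (\<lambda>t. u (?p t))" "continuous_on S' (\<lambda>t. u (?p (- t)))"
    if "continuous_on {a..b} u" "S \<subseteq> {-1..1}" "S' \<subseteq> {-1..1}" for u S S'
  proof -
    show "continuous_on S (\<lambda>t. u (?p t))"
      using that p_in by (intro continuous_on_compose2[OF that(1) continuous_on_log_path[OF ab]]) auto
    have cont_neg: "continuous_on S' (\<lambda>t. ?p (- t))"
      by (rule continuous_on_compose2[OF continuous_on_log_path[OF ab, of UNIV]]) (auto intro!: continuous_intros)
    have "?p (- t) \<in> {a..b}" if "t \<in> S'" for t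
      using that \<open>S' \<subseteq> {-1..1}\<close> by (intro p_in) force
    then show "continuous_on S' (\<lambda>t. u (?p (- t)))"
      by (intro continuous_on_compose2[OF that(1) cont_neg]) auto
  qed
  define \<psi> where "\<psi> = (\<lambda>t. f (?p t) + f (?p (- t)))"
  define \<psi>' where "\<psi>' = (\<lambda>t. deriv f (?p t) * (h * ?p t) - deriv f (?p (- t)) * (h * ?p (- t)))"
  \<comment> \<open>The factors \<open>h * ?p t\<close> and \<open>h * ?p (- t)\<close> are the
    speeds of the path; the brackets are the GA-convexity bounds on the derivative of
    \<open>f\<close> between \<open>G\<close> and \<open>b\<close>, and between \<open>G\<close> and
    \<open>a\<close>.\<close>
  define H where "H = (\<lambda>t. h * (?p t * (t * ?B + (1 - t) * ?M) + ?p (- t) * (t * ?A + (1 - t) * ?M)))"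
  define w where "w = (\<lambda>t. g (?p t))"
  let ?k = "\<lambda>t. (1 - t) powr (\<alpha> - 1) + (1 + t) powr (\<alpha> - 1)"
  have w_even: "w (- t) = w t" if "t \<in> {-1..1}" for t
    using sym p_in[OF that] by (simp add: w_def log_path_reflect[OF ab] geom_symmetric_on_def)
  have \<psi>_deriv: "(\<psi> has_real_derivative \<psi>' t) (at t)" if t: "t \<in> {0<..<1}" for t
  proof -
    have "((\<lambda>t. f (?p t)) has_real_derivative deriv f (?p t) * (h * ?p t)) (at t)"
      unfolding h_def using t p_in by (intro DERIV_chain2[of f] f_deriv log_path_deriv[OF ab]) auto
    moreover have "((\<lambda>t. f (?p (- t))) has_real_derivative deriv f (?p (- t)) * (h * ?p (- t) * -1)) (at t)"
      unfolding h_def using t p_in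
      by (intro DERIV_chain2[of f] f_deriv DERIV_chain2[of ?p] log_path_deriv[OF ab])
         (auto intro!: derivative_eq_intros)
    ultimately show ?thesis
      unfolding \<psi>_def \<psi>'_def by (auto intro!: derivative_eq_intros)
  qed
  have \<psi>'_le: "\<bar>\<psi>' t\<bar> \<le> H t" if t: "t \<in> {0<..<1}" for t
  proof -
    have Gin: "G \<in> {a..b}"
      using p_in[of 0] log_path_powr(1)[OF ab G, of 0] G ab by simp
    have "\<bar>deriv f (?p t)\<bar> \<le> t * ?B + (1 - t) * ?M" "\<bar>deriv f (?p (- t))\<bar> \<le> t * ?A + (1 - t) * ?M"
      \<comment> \<open>The points at \<open>- t\<close> are rewritten first, as means of
        \<open>a\<close> and \<open>G\<close>; the formula with \<open>b\<close>, taken at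
        \<open>- t\<close>, would have exponents outside [0, 1].\<close>
      using GA t Gin ab unfolding GA_convex_on_def log_path_powr(2)[OF ab G]
      unfolding log_path_powr(1)[OF ab G] by auto
    then have "\<bar>deriv f (?p t)\<bar> * ?p t \<le> (t * ?B + (1 - t) * ?M) * ?p t"
      "\<bar>deriv f (?p (- t))\<bar> * ?p (- t) \<le> (t * ?A + (1 - t) * ?M) * ?p (- t)"
      by (auto intro!: mult_right_mono)
    then have "h * (\<bar>deriv f (?p t)\<bar> * ?p t + \<bar>deriv f (?p (- t))\<bar> * ?p (- t)) \<le> H t"
      unfolding H_def using h by (intro mult_left_mono) (auto simp: mult.commute)
    moreover have "\<bar>\<psi>' t\<bar> \<le> \<bar>deriv f (?p t) * (h * ?p t)\<bar> + \<bar>deriv f (?p (- t)) * (h * ?p (- t))\<bar>"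
      unfolding \<psi>'_def by (rule abs_triangle_ineq4)
    ultimately show ?thesis using h by (simp add: abs_mult algebra_simps)
  qed
  have w_le: "\<bar>w t\<bar> \<le> N" if "t \<in> {0..1}" for t
    unfolding w_def N_def using p_in[of t] that by (intro abs_le_sup_norm_on g) auto
  have cont: "continuous_on {0..1} \<psi>" "continuous_on {0..1} w" "continuous_on {0..1} H"
    unfolding \<psi>_def w_def H_def
    by (intro continuous_intros comp_cont[OF f_cont] comp_cont[OF g] comp_cont[OF continuous_on_id]; auto)+
  note k_int = absolutely_integrable_symmetric_kernel[OF \<alpha>, THEN set_lebesgue_integral_eq_integral(1)]
  define c where "c = h powr \<alpha> / Gamma \<alpha>"
  have c: "c \<ge> 0" using \<alpha> by (simp add: c_def)
  \<comment> \<open>The 2 comes from evenness of \<open>w\<close> and cancels the denominator of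
    \<open>(f a + f b) / 2\<close>, whose numerator is \<open>\<psi> 1\<close>.\<close>
  have "hadamard_left \<alpha> a g b + hadamard_right \<alpha> b g a = c * integral {0..1} (\<lambda>t. 2 * (?k t * w t))"
    unfolding hadamard_sum_log_path[OF ab \<alpha> g] c_def h_def
    by (rule arg_cong[where f = "(*) _"], rule Henstock_Kurzweil_Integration.integral_cong)
       (use w_even in \<open>simp add: w_def\<close>)
  then have S1: "(f a + f b) / 2 * (hadamard_left \<alpha> a g b + hadamard_right \<alpha> b g a) =
      c * (\<psi> 1 * integral {0..1} (\<lambda>t. ?k t * w t))"
    by (simp add: \<psi>_def)
  \<comment> \<open>Evenness lets the common factor \<open>w t\<close> be pulled out of the values
    of \<open>f * g\<close> at both points, leaving \<open>\<psi> t\<close>.\<close>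
  have S2: "hadamard_left \<alpha> a (\<lambda>x. f x * g x) b + hadamard_right \<alpha> b (\<lambda>x. f x * g x) a =
      c * integral {0..1} (\<lambda>t. ?k t * (w t * \<psi> t))"
    unfolding hadamard_sum_log_path[OF ab \<alpha> continuous_on_mult[OF f_cont g]] c_def h_def
    by (rule arg_cong[where f = "(*) _"], rule Henstock_Kurzweil_Integration.integral_cong)
       (use w_even in \<open>simp add: w_def \<psi>_def algebra_simps\<close>)
  have "integral {0..1} (\<lambda>t. ?k t * (w t * (\<psi> 1 - \<psi> t))) =
      integral {0..1} (\<lambda>t. \<psi> 1 * (?k t * w t) - ?k t * (w t * \<psi> t))"
    by (simp add: algebra_simps)
  also have "\<dots> = \<psi> 1 * integral {0..1} (\<lambda>t. ?k t * w t) - integral {0..1} (\<lambda>t. ?k t * (w t * \<psi> t))"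
    using integrable_on_cmult_left[OF k_int[OF cont(2)], of "\<psi> 1"] k_int[OF continuous_on_mult[OF cont(2,1)]]
    by (subst integral_diff) simp_all
  finally have S3: "(f a + f b) / 2 * (hadamard_left \<alpha> a g b + hadamard_right \<alpha> b g a)
       - (hadamard_left \<alpha> a (\<lambda>x. f x * g x) b + hadamard_right \<alpha> b (\<lambda>x. f x * g x) a) =
      c * integral {0..1} (\<lambda>t. ?k t * (w t * (\<psi> 1 - \<psi> t)))"
    unfolding S1 S2 by (simp add: right_diff_distrib)
  let ?\<kappa> = "\<lambda>t. (1 + t) powr \<alpha> - (1 - t) powr \<alpha>"
  let ?c1 = "\<lambda>t. ?\<kappa> t * t * a powr t * G powr (1 - t)"
  let ?c2 = "\<lambda>t. (1 - t) * ?\<kappa> t * (a powr t * G powr (1 - t) + b powr t * G powr (1 - t))"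
  let ?c3 = "\<lambda>t. ?\<kappa> t * t * b powr t * G powr (1 - t)"
  have "G > 0" using G ab by simp
  then have int: "?c1 integrable_on {0..1}" "?c2 integrable_on {0..1}" "?c3 integrable_on {0..1}"
    using ab \<alpha> by (intro integrable_continuous_interval continuous_on_powr' continuous_intros; auto)+
  \<comment> \<open>\<open>H\<close> is linear in the three derivative values: the endpoint terms
    give \<open>C1\<close> and \<open>C3\<close>, and the two terms in \<open>?M\<close> merge into
    \<open>C2\<close>.\<close>
  have "(\<lambda>t. ?\<kappa> t * H t) = (\<lambda>t. h * (?c1 t * ?A + ?c2 t * ?M + ?c3 t * ?B))"
    unfolding H_def log_path_powr(2)[OF ab G]
    unfolding log_path_powr(1)[OF ab G] by (auto simp: algebra_simps)
  then have \<kappa>H: "integral {0..1} (\<lambda>t. ?\<kappa> t * H t) = h * (C1 a G \<alpha> * ?A + C2 a b G \<alpha> * ?M + C3 b G \<alpha> * ?B)"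
    unfolding C1_def C2_def C3_def
    by (simp add: integral_add integrable_add integrable_on_mult_left int del: integral_mult_right_zero)
  have "\<bar>c * integral {0..1} (\<lambda>t. ?k t * (w t * (\<psi> 1 - \<psi> t)))\<bar>
      \<le> c * (N / \<alpha> * integral {0..1} (\<lambda>t. ?\<kappa> t * H t))"
    unfolding abs_mult abs_of_nonneg[OF c]
    by (rule mult_left_mono[OF weighted_increment_bound[OF \<alpha> cont(1) \<psi>_deriv cont(3) \<psi>'_le cont(2) w_le] c])
  \<comment> \<open>The extra factor \<open>h\<close> stems from \<open>H\<close>, and
    \<open>1 / \<alpha>\<close> from the primitive of the kernel; the latter is absorbed by the
    recurrence of the Gamma function.\<close>
  also have "\<dots> = h powr (\<alpha> + 1) / Gamma (\<alpha> + 1) * N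
        * (C1 a G \<alpha> * ?A + C2 a b G \<alpha> * ?M + C3 b G \<alpha> * ?B)"
  proof -
    have "Gamma (\<alpha> + 1) = \<alpha> * Gamma \<alpha>"
      using \<alpha> by (intro Gamma_plus1) (auto elim!: nonpos_Ints_cases)
    moreover have "h powr (\<alpha> + 1) = h powr \<alpha> * h"
      using h by (simp add: powr_add)
    ultimately show ?thesis unfolding \<kappa>H c_def by (simp add: mult_ac)
  qed
  also have "h powr (\<alpha> + 1) / Gamma (\<alpha> + 1) =
      (ln b - ln a) powr (\<alpha> + 1) / (2 powr (\<alpha> + 1) * Gamma (\<alpha> + 1))"
    using ab by (simp add: h_def powr_divide)
  finally show ?thesis unfolding S3 N_def .
qed

section \<open>Both bounds, the second by comparing coefficients\<close>

theorem corollary1: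
  fixes I :: "real set" and f g :: "real \<Rightarrow> real" and a b \<alpha> G :: real
  assumes "is_interval I" and "I \<subseteq> {0<..}"
    and "f differentiable_on interior I"
    and "a \<in> interior I" and "b \<in> interior I" and "a < b"
    and "GA_convex_on {a..b} (\<lambda>x. \<bar>deriv f x\<bar>)"
    and "continuous_on {a..b} g"
    and "\<And>x. x \<in> {a..b} \<Longrightarrow> 0 \<le> g x"
    and "geom_symmetric_on a b g"
    and "\<alpha> > 0"
    and "G = sqrt (a * b)"
  shows
    "\<bar>(f a + f b) / 2 * (hadamard_left \<alpha> a g b + hadamard_right \<alpha> b g a)
       - (hadamard_left \<alpha> a (\<lambda>x. f x * g x) b + hadamard_right \<alpha> b (\<lambda>x. f x * g x) a)\<bar>
     \<le> (ln b - ln a) powr (\<alpha> + 1) / (2 powr (\<alpha> + 1) * Gamma (\<alpha> + 1)) * sup_norm_on a b g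
        * (C1 a G \<alpha> * \<bar>deriv f a\<bar> + C2 a b G \<alpha> * \<bar>deriv f G\<bar> + C3 b G \<alpha> * \<bar>deriv f b\<bar>)
    \<and> (\<alpha> \<le> 1 \<longrightarrow>
     \<bar>(f a + f b) / 2 * (hadamard_left \<alpha> a g b + hadamard_right \<alpha> b g a)
       - (hadamard_left \<alpha> a (\<lambda>x. f x * g x) b + hadamard_right \<alpha> b (\<lambda>x. f x * g x) a)\<bar>
     \<le> (ln b - ln a) powr (\<alpha> + 1) / (2 * Gamma (\<alpha> + 1)) * sup_norm_on a b g
        * (D1 a G \<alpha> * \<bar>deriv f a\<bar> + D2 a b G \<alpha> * \<bar>deriv f G\<bar> + D3 b G \<alpha> * \<bar>deriv f b\<bar>))"
    (is "?E \<le> ?bound1 \<and> (_ \<longrightarrow> _ \<le> ?bound2)")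
proof (intro conjI impI)
  show le1: "?E \<le> ?bound1"
    using assms by (intro hadamard_fejer_bound[of I]) auto
  assume "\<alpha> \<le> 1"
  have pos: "0 < a" "0 < b" "0 < G" "0 < \<alpha>"
    using assms interior_subset[of I] by auto
  have \<kappa>: "((1 + t) powr \<alpha> - (1 - t) powr \<alpha>) * r \<le> 2 powr \<alpha> * t powr \<alpha> * r"
    if "t \<in> {0..1}" "0 \<le> r" for t r
    using powr_diff_le[of t \<alpha>] that pos \<open>\<alpha> \<le> 1\<close> by (intro mult_right_mono) auto
  have t_powr: "t powr (\<alpha> + 1) = t powr \<alpha> * t" if "0 \<le> t" for t
    using that by (simp add: powr_add)
  \<comment> \<open>The integrands are compared pointwise: \<open>\<kappa>\<close> is applied with
    \<open>r\<close> the remaining nonnegative factor. The other two coefficients are treated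
    alike.\<close>
  have C1: "C1 a G \<alpha> \<le> 2 powr \<alpha> * D1 a G \<alpha>"
    unfolding C1_def D1_def integral_mult_right[symmetric]
  proof (intro integral_le integrable_continuous_interval continuous_on_powr' continuous_intros)
    show "((1 + t) powr \<alpha> - (1 - t) powr \<alpha>) * t * a powr t * G powr (1 - t)
        \<le> 2 powr \<alpha> * (t powr (\<alpha> + 1) * a powr t * G powr (1 - t))" if "t \<in> {0..1}" for t
      using \<kappa>[OF that, of "t * a powr t * G powr (1 - t)"] that by (simp add: t_powr mult_ac)
  qed (use pos in auto)
  have C3: "C3 b G \<alpha> \<le> 2 powr \<alpha> * D3 b G \<alpha>"
    unfolding C3_def D3_def integral_mult_right[symmetric]
  proof (intro integral_le integrable_continuous_interval continuous_on_powr' continuous_intros)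
    show "((1 + t) powr \<alpha> - (1 - t) powr \<alpha>) * t * b powr t * G powr (1 - t)
        \<le> 2 powr \<alpha> * (t powr (\<alpha> + 1) * b powr t * G powr (1 - t))" if "t \<in> {0..1}" for t
      using \<kappa>[OF that, of "t * b powr t * G powr (1 - t)"] that by (simp add: t_powr mult_ac)
  qed (use pos in auto)
  have C2: "C2 a b G \<alpha> \<le> 2 powr \<alpha> * D2 a b G \<alpha>"
    unfolding C2_def D2_def integral_mult_right[symmetric]
  proof (intro integral_le integrable_continuous_interval continuous_on_powr' continuous_intros)
    show "(1 - t) * ((1 + t) powr \<alpha> - (1 - t) powr \<alpha>) * (a powr t * G powr (1 - t) + b powr t * G powr (1 - t))
        \<le> 2 powr \<alpha> * ((1 - t) * t powr \<alpha> * a powr t * G powr (1 - t) +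
                       (1 - t) * t powr \<alpha> * b powr t * G powr (1 - t))" if t: "t \<in> {0..1}" for t
    proof -
      have "0 \<le> (1 - t) * (a powr t * G powr (1 - t) + b powr t * G powr (1 - t))"
        using t by simp
      from \<kappa>[OF t this] show ?thesis by (simp only: algebra_simps)
    qed
  qed (use pos in auto)
  let ?A = "\<bar>deriv f a\<bar>" and ?B = "\<bar>deriv f b\<bar>" and ?M = "\<bar>deriv f G\<bar>"
  let ?K = "(ln b - ln a) powr (\<alpha> + 1) / (2 powr (\<alpha> + 1) * Gamma (\<alpha> + 1)) * sup_norm_on a b g"
  have "0 \<le> sup_norm_on a b g"
    using abs_le_sup_norm_on[OF assms(8), of a] assms(6) by simp
  then have K: "0 \<le> ?K" using pos by simp
  note le1
  also have "?bound1 \<le> ?K * (2 powr \<alpha> * D1 a G \<alpha> * ?A + 2 powr \<alpha> * D2 a b G \<alpha> * ?M + 2 powr \<alpha> * D3 b G \<alpha> * ?B)"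
    by (intro mult_left_mono[OF _ K] add_mono mult_right_mono C1 C2 C3) auto
  also have "\<dots> = ?K * 2 powr \<alpha> * (D1 a G \<alpha> * ?A + D2 a b G \<alpha> * ?M + D3 b G \<alpha> * ?B)"
    by (simp only: distrib_left distrib_right mult_ac)
  \<comment> \<open>Of \<open>2 powr (\<alpha> + 1)\<close> in the denominator only a single 2
    remains.\<close>
  also have "?K * 2 powr \<alpha> = (ln b - ln a) powr (\<alpha> + 1) / (2 * Gamma (\<alpha> + 1)) * sup_norm_on a b g"
    by (simp add: powr_add)
  finally show "?E \<le> ?bound2" .
qed

end
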